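(* Consider a graph-based Markov decision process with $n$ agents, influence graph $(\mathcal V,\mathcal E)$, bounded local rewards, and a joint policy $\pi$; in particular the global reward factorises as $r^t=n^{-1}\sum_{i\in\mathcal V}R_i^t$. Let $\gamma\in(0,1)$, $\Gamma=\gamma\,\mathbb A D^{-1}$, let $$V_D(S)=\mathbb E_\pi\Big[\sum_{t=0}^\infty\Gamma^{t+1}R^t\;\Big|\;S^0=S\Big]\in\mathbb R^n$$ be the diffusion value function, and let $$V(S)=\mathbb E_\pi\Big[\sum_{t=0}^\infty\gamma^{t+1}r^t\;\Big|\;S^0=S\Big]\in\mathbb R$$ be the global value function. Then for any state $S$, $$n^{-1}\mathbf 1^\top V_D(S)=V(S),$$ where $\mathbf 1\in\mathbb R^n$ is the all-ones vector.
   Context: Graph-based Markov decision process (GMDP). Agents are indexed by $\mathcal V=\{1,\dots,n\}$. Agent $i$ has local state space $\mathcal S_i$ and action space $\mathcal A_i$; there is an additional space $\mathcal S_0$ of global/unobserved state variables. The joint spaces are $\mathcal S=\prod_{i\in\mathcal V\cup\{0\}}\mathcal S_i$ and $\mathcal A=\prod_{i\in\mathcal V}\mathcal A_i$ (measurable spaces; all functions and kernels are measurable). The influence graph $(\mathcal V,\mathcal E)$ is a directed graph with $(i,i)\in\mathcal E$ for all $i$. For a node $i$ let $N_i^{\mathrm{in}}=\{j:(j,i)\in\mathcal E\}$, and for $N\subseteq\mathcal V$ write $X_N=(X_j)_{j\in N}$. Rewards and transitions factorise as $$\mathcal R(S,A)=n^{-1}\sum_{i\in\mathcal V}\mathcal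 R_i(S_{N_i^{\mathrm{in}}},S_0;A_{N_i^{\mathrm{in}}}),\qquad T(S'|S,A)=T_0(S_0'|S_0)\prod_{i\in\mathcal V}T_i(S_i'|S_{N_i^{\mathrm{in}}},S_0;A_{N_i^{\mathrm{in}}}).$$ At time $t$ the state is $S^t$, the joint action is $A^t$, and $S^{t+1}\sim T(\cdot|S^t,A^t)$. The local reward at node $i$ is $R_i^t=\mathcal R_i(S^t_{N_i^{\mathrm{in}}},S_0^t;A^t_{N_i^{\mathrm{in}}})\in\mathbb R$, $R^t=(R_1^t,\dots,R_n^t)^\top$, and the global reward is $r^t=\mathcal R(S^t,A^t)$. A joint policy is $\pi=(\pi_1,\dots,\pi_n)$, where $\pi_i$ maps the local history $\tau_i^t=(S_i^{0:t},A_i^{0:t-1})$ to a distribution over $\mathcal A_i$; given the histories, agents draw their actions independently. $\mathbb E_\pi$ denotes expectation under the resulting process. $\mathbb A\in\{0,1\}^{n\times n}$ is the adjacency matrix of the influence graph ($\mathbb A_{ij}=1$ iff $(i,j)\in\mathcal E$), and $D$ is the diagonal in-degree matrix, $D_{ii}=\sum_j\mathbb A_{ji}$ (positive by self-connectedness). *)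

theory Defs
  imports "HOL-Probability.Probability"
begin

text \<open>
  Agents are the elements of a finite type \<open>'n\<close>, so the number \<open>n\<close> of agents is \<open>CARD('n)\<close>.
  The local state spaces may differ from agent to agent: they are measurable spaces
  (\<open>measure\<close> objects of which only the carrier and the sigma-algebra are used) on one
  common type \<open>'s\<close>. Likewise for the action spaces on \<open>'a\<close>. The state component with index
  0 lives on its own type \<open>'z\<close>, so a joint state is a pair of the local states and
  the global state.
\<close>

record ('n, 's, 'z, 'a) gmdp =
  edges :: "('n \<times> 'n) set"
  local_space :: "'n \<Rightarrow> 's measure"
  global_space :: "'z measure"
  action_space :: "'n \<Rightarrow> 'a measure"
  local_reward :: "'n \<Rightarrow> ('n \<Rightarrow> 's) \<times> 'z \<times> ('n \<Rightarrow> 'a) \<Rightarrow> real"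
  global_kernel :: "'z \<Rightarrow> 'z measure"
  local_kernel :: "'n \<Rightarrow> ('n \<Rightarrow> 's) \<times> 'z \<times> ('n \<Rightarrow> 'a) \<Rightarrow> 's measure"

definition in_nbhd :: "('n, 's, 'z, 'a) gmdp \<Rightarrow> 'n \<Rightarrow> 'n set" where
  "in_nbhd G i = {j. (j, i) \<in> edges G}"

definition state_space :: "('n, 's, 'z, 'a) gmdp \<Rightarrow> (('n \<Rightarrow> 's) \<times> 'z) measure" where
  "state_space G = (\<Pi>\<^sub>M i\<in>UNIV. local_space G i) \<Otimes>\<^sub>M global_space G"

definition joint_action_space :: "('n, 's, 'z, 'a) gmdp \<Rightarrow> ('n \<Rightarrow> 'a) measure" where
  "joint_action_space G = (\<Pi>\<^sub>M i\<in>UNIV. action_space G i)"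

definition nbhd_space ::
    "('n, 's, 'z, 'a) gmdp \<Rightarrow> 'n \<Rightarrow> (('n \<Rightarrow> 's) \<times> 'z \<times> ('n \<Rightarrow> 'a)) measure" where
  "nbhd_space G i = (\<Pi>\<^sub>M j\<in>in_nbhd G i. local_space G j) \<Otimes>\<^sub>M global_space G \<Otimes>\<^sub>M
     (\<Pi>\<^sub>M j\<in>in_nbhd G i. action_space G j)"

definition nbhd_view :: "('n, 's, 'z, 'a) gmdp \<Rightarrow> 'n \<Rightarrow> ('n \<Rightarrow> 's) \<times> 'z \<Rightarrow> ('n \<Rightarrow> 'a) \<Rightarrow>
    ('n \<Rightarrow> 's) \<times> 'z \<times> ('n \<Rightarrow> 'a)" where
  "nbhd_view G i s a = (restrict (fst s) (in_nbhd G i), snd s, restrict a (in_nbhd G i))"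

definition is_gmdp :: "('n::finite, 's, 'z, 'a) gmdp \<Rightarrow> bool" where
  "is_gmdp G \<longleftrightarrow>
     (\<forall>i. (i, i) \<in> edges G) \<and>
     (\<forall>i. local_reward G i \<in> borel_measurable (nbhd_space G i)) \<and>
     global_kernel G \<in> global_space G \<rightarrow>\<^sub>M prob_algebra (global_space G) \<and>
     (\<forall>i. local_kernel G i \<in> nbhd_space G i \<rightarrow>\<^sub>M prob_algebra (local_space G i))"

definition bounded_rewards :: "('n::finite, 's, 'z, 'a) gmdp \<Rightarrow> bool" where
  "bounded_rewards G \<longleftrightarrow> (\<forall>i. bounded (local_reward G i ` space (nbhd_space G i)))"

definition reward_vec ::
    "('n::finite, 's, 'z, 'a) gmdp \<Rightarrow> ('n \<Rightarrow> 's) \<times> 'z \<Rightarrow> ('n \<Rightarrow> 'a) \<Rightarrow> real ^ 'n" where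
  "reward_vec G s a = (\<chi> i. local_reward G i (nbhd_view G i s a))"

definition global_reward ::
    "('n::finite, 's, 'z, 'a) gmdp \<Rightarrow> ('n \<Rightarrow> 's) \<times> 'z \<Rightarrow> ('n \<Rightarrow> 'a) \<Rightarrow> real" where
  "global_reward G s a =
     inverse (real CARD('n)) * (\<Sum>i\<in>UNIV. local_reward G i (nbhd_view G i s a))"

definition transition :: "('n::finite, 's, 'z, 'a) gmdp \<Rightarrow> ('n \<Rightarrow> 's) \<times> 'z \<Rightarrow> ('n \<Rightarrow> 'a) \<Rightarrow>
    (('n \<Rightarrow> 's) \<times> 'z) measure" where
  "transition G s a =
     (\<Pi>\<^sub>M i\<in>UNIV. local_kernel G i (nbhd_view G i s a)) \<Otimes>\<^sub>M global_kernel G (snd s)"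

text \<open>
  \<open>\<pi> i t\<close> is the policy of agent \<open>i\<close> at time \<open>t\<close>, a kernel on local histories. The local
  history at time \<open>t\<close> has states at times \<open>0..t\<close> but actions only at times \<open>0..t-1\<close>.
\<close>

type_synonym ('n, 's, 'a) joint_policy =
  "'n \<Rightarrow> nat \<Rightarrow> (nat \<Rightarrow> 's) \<times> (nat \<Rightarrow> 'a) \<Rightarrow> 'a measure"

definition history_space ::
    "('n, 's, 'z, 'a) gmdp \<Rightarrow> 'n \<Rightarrow> nat \<Rightarrow> ((nat \<Rightarrow> 's) \<times> (nat \<Rightarrow> 'a)) measure" where
  "history_space G i t =
     (\<Pi>\<^sub>M k\<in>{0..t}. local_space G i) \<Otimes>\<^sub>M (\<Pi>\<^sub>M k\<in>{0..<t}. action_space G i)"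

definition is_policy :: "('n::finite, 's, 'z, 'a) gmdp \<Rightarrow> ('n, 's, 'a) joint_policy \<Rightarrow> bool" where
  "is_policy G \<pi> \<longleftrightarrow> (\<forall>i t. \<pi> i t \<in> history_space G i t \<rightarrow>\<^sub>M prob_algebra (action_space G i))"

definition local_history :: "'n \<Rightarrow> nat \<Rightarrow> (nat \<Rightarrow> ('n \<Rightarrow> 's) \<times> 'z) \<Rightarrow> (nat \<Rightarrow> 'n \<Rightarrow> 'a) \<Rightarrow>
    (nat \<Rightarrow> 's) \<times> (nat \<Rightarrow> 'a)" where
  "local_history i t S A = (\<lambda>k\<in>{0..t}. fst (S k) i, \<lambda>k\<in>{0..<t}. A k i)"

definition joint_action_law :: "('n::finite, 's, 'a) joint_policy \<Rightarrow> nat \<Rightarrow>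
    (nat \<Rightarrow> ('n \<Rightarrow> 's) \<times> 'z) \<Rightarrow> (nat \<Rightarrow> 'n \<Rightarrow> 'a) \<Rightarrow> ('n \<Rightarrow> 'a) measure" where
  "joint_action_law \<pi> t S A = (\<Pi>\<^sub>M i\<in>UNIV. \<pi> i t (local_history i t S A))"

text \<open>
  A trajectory \<open>\<omega>\<close> maps each time \<open>t\<close> to the pair \<open>\<omega> t\<close> of the joint state and the joint
  action at \<open>t\<close>.
  \<open>step_kernel G \<pi> s0 t \<omega>\<close> is the conditional law of the pair at time \<open>t\<close> given the pairs
  \<open>\<omega> 0, \<dots>, \<omega> (t - 1)\<close>, for the process started in \<open>s0\<close>: first the state \<open>s\<close> at time \<open>t\<close>
  is drawn, then the action given the state history, which \<open>\<omega>\<close> supplies only before time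
  \<open>t\<close> and which is therefore updated by \<open>s\<close>.
\<close>

definition stage_space ::
    "('n, 's, 'z, 'a) gmdp \<Rightarrow> ((('n \<Rightarrow> 's) \<times> 'z) \<times> ('n \<Rightarrow> 'a)) measure" where
  "stage_space G = state_space G \<Otimes>\<^sub>M joint_action_space G"

definition step_kernel :: "('n::finite, 's, 'z, 'a) gmdp \<Rightarrow> ('n, 's, 'a) joint_policy \<Rightarrow>
    ('n \<Rightarrow> 's) \<times> 'z \<Rightarrow> nat \<Rightarrow> (nat \<Rightarrow> (('n \<Rightarrow> 's) \<times> 'z) \<times> ('n \<Rightarrow> 'a)) \<Rightarrow>
    ((('n \<Rightarrow> 's) \<times> 'z) \<times> ('n \<Rightarrow> 'a)) measure" where
  "step_kernel G \<pi> s0 t \<omega> =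
     (case t of
        0 \<Rightarrow> return (state_space G) s0
      | Suc k \<Rightarrow> transition G (fst (\<omega> k)) (snd (\<omega> k))) \<bind>
     (\<lambda>s. distr (joint_action_law \<pi> t ((\<lambda>k. fst (\<omega> k))(t := s)) (\<lambda>k. snd (\<omega> k)))
             (stage_space G) (\<lambda>a. (s, a)))"

text \<open>
  The law of the whole trajectory is the projective limit that the Ionescu-Tulcea theorem
  provides for the step kernels; \<open>Ionescu_Tulcea.CI\<close> gives its finite-dimensional marginals.
  That the theorem applies is lemma \<open>Ionescu_Tulcea_step_kernel\<close> below. Conditioning on the
  initial state \<open>s0\<close> is rendered by starting the process in \<open>s0\<close>.
\<close>

definition trajectory_law :: "('n::finite, 's, 'z, 'a) gmdp \<Rightarrow> ('n, 's, 'a) joint_policy \<Rightarrow>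
    ('n \<Rightarrow> 's) \<times> 'z \<Rightarrow> (nat \<Rightarrow> (('n \<Rightarrow> 's) \<times> 'z) \<times> ('n \<Rightarrow> 'a)) measure" where
  "trajectory_law G \<pi> s0 =
     projective_family.lim UNIV
       (Ionescu_Tulcea.CI (step_kernel G \<pi> s0) (\<lambda>_. stage_space G)) (\<lambda>_. stage_space G)"

definition adjacency :: "('n::finite, 's, 'z, 'a) gmdp \<Rightarrow> real ^ 'n ^ 'n" where
  "adjacency G = (\<chi> i j. if (i, j) \<in> edges G then 1 else 0)"

definition in_degree_matrix :: "('n::finite, 's, 'z, 'a) gmdp \<Rightarrow> real ^ 'n ^ 'n" where
  "in_degree_matrix G = (\<chi> i j. if i = j then \<Sum>k\<in>UNIV. adjacency G $ k $ i else 0)"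

definition diffusion_matrix :: "('n::finite, 's, 'z, 'a) gmdp \<Rightarrow> real \<Rightarrow> real ^ 'n ^ 'n" where
  "diffusion_matrix G \<gamma> = \<gamma> *\<^sub>R (adjacency G ** matrix_inv (in_degree_matrix G))"

text \<open>
  The overloaded power on \<open>real ^ 'n ^ 'n\<close> is componentwise, so matrix powers need a
  separate definition.
\<close>

definition matrix_pow :: "real ^ 'n ^ 'n \<Rightarrow> nat \<Rightarrow> real ^ ('n::finite) ^ 'n" where
  "matrix_pow X k = (((**) X) ^^ k) (mat 1)"

definition diffusion_value :: "('n::finite, 's, 'z, 'a) gmdp \<Rightarrow> ('n, 's, 'a) joint_policy \<Rightarrow>
    real \<Rightarrow> ('n \<Rightarrow> 's) \<times> 'z \<Rightarrow> real ^ 'n" where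
  "diffusion_value G \<pi> \<gamma> s0 =
     (\<integral>\<omega>. (\<Sum>t. matrix_pow (diffusion_matrix G \<gamma>) (t + 1) *v reward_vec G (fst (\<omega> t)) (snd (\<omega> t)))
        \<partial>trajectory_law G \<pi> s0)"

definition global_value :: "('n::finite, 's, 'z, 'a) gmdp \<Rightarrow> ('n, 's, 'a) joint_policy \<Rightarrow>
    real \<Rightarrow> ('n \<Rightarrow> 's) \<times> 'z \<Rightarrow> real" where
  "global_value G \<pi> \<gamma> s0 =
     (\<integral>\<omega>. (\<Sum>t. \<gamma> ^ (t + 1) * global_reward G (fst (\<omega> t)) (snd (\<omega> t)))
        \<partial>trajectory_law G \<pi> s0)"

lemma measurable_PiM_kernel:
  fixes N :: "'n::finite \<Rightarrow> 'b measure"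
  assumes K: "\<And>i. K i \<in> M \<rightarrow>\<^sub>M prob_algebra (N i)"
  shows "(\<lambda>x. \<Pi>\<^sub>M i\<in>UNIV. K i x) \<in> M \<rightarrow>\<^sub>M prob_algebra (\<Pi>\<^sub>M i\<in>UNIV. N i)"
proof (rule measurable_prob_algebra_generated[OF sets_PiM Int_stable_prod_algebra
      prod_algebra_sets_into_space])
  have K': "prob_space (K i x)" "sets (K i x) = sets (N i)" if "x \<in> space M" for i x
    using measurable_space[OF K that] by (auto simp: space_prob_algebra)
  show "prob_space (\<Pi>\<^sub>M i\<in>UNIV. K i x)" if "x \<in> space M" for x
    using K'(1)[OF that] by (intro prob_space_PiM)
  show "sets (\<Pi>\<^sub>M i\<in>UNIV. K i x) = sets (\<Pi>\<^sub>M i\<in>UNIV. N i)" if "x \<in> space M" for x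
    using K'(2)[OF that] by (intro sets_PiM_cong) auto
  fix A assume "A \<in> prod_algebra UNIV N"
  then obtain E where A: "A = Pi\<^sub>E UNIV E" and E: "\<And>i. E i \<in> sets (N i)"
    by (elim prod_algebraE_all) auto
  have "emeasure (\<Pi>\<^sub>M i\<in>UNIV. K i x) A = (\<Prod>i\<in>UNIV. emeasure (K i x) (E i))"
    if x: "x \<in> space M" for x
  proof -
    interpret product_prob_space "\<lambda>i. K i x" UNIV
      using K'(1)[OF x]
      by (intro product_prob_space.intro product_sigma_finite.intro product_prob_space_axioms.intro
          finite_measure.sigma_finite_measure prob_space.finite_measure) auto
    show ?thesis
      unfolding A using E K'(2)[OF x] by (intro emeasure_PiM) auto
  qed
  moreover have "(\<lambda>x. \<Prod>i\<in>UNIV. emeasure (K i x) (E i)) \<in> borel_measurable M"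
    by (intro borel_measurable_prod_ennreal measurable_emeasure_kernel[OF _ E]
        measurable_prob_algebraD[OF K])
  ultimately show "(\<lambda>x. emeasure (\<Pi>\<^sub>M i\<in>UNIV. K i x) A) \<in> borel_measurable M"
    by (simp cong: measurable_cong)
qed

lemma measurable_nbhd_view:
  "(\<lambda>x. nbhd_view G i (fst x) (snd x)) \<in> stage_space G \<rightarrow>\<^sub>M nbhd_space G i"
  unfolding nbhd_view_def stage_space_def state_space_def joint_action_space_def nbhd_space_def
  by measurable

lemma measurable_transition:
  assumes "is_gmdp G"
  shows "(\<lambda>x. transition G (fst x) (snd x)) \<in> stage_space G \<rightarrow>\<^sub>M prob_algebra (state_space G)"
proof -
  have loc: "(\<lambda>x. local_kernel G i (nbhd_view G i (fst x) (snd x)))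
      \<in> stage_space G \<rightarrow>\<^sub>M prob_algebra (local_space G i)" for i
    using assms measurable_compose[OF measurable_nbhd_view[of G i], of "local_kernel G i"]
    unfolding is_gmdp_def by blast
  have "(\<lambda>x. snd (fst x)) \<in> stage_space G \<rightarrow>\<^sub>M global_space G"
    unfolding stage_space_def state_space_def by measurable
  from measurable_compose[OF this, of "global_kernel G"]
  have glob: "(\<lambda>x. global_kernel G (snd (fst x)))
      \<in> stage_space G \<rightarrow>\<^sub>M prob_algebra (global_space G)"
    using assms unfolding is_gmdp_def by blast
  show ?thesis
    unfolding transition_def state_space_def
    by (intro measurable_pair_prob measurable_PiM_kernel loc glob)
qed

lemma measurable_joint_action_law:
  assumes "is_policy G \<pi>"
    and S: "\<And>k. k \<le> t \<Longrightarrow> (\<lambda>x. S x k) \<in> M \<rightarrow>\<^sub>M state_space G"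
    and A: "\<And>k. k < t \<Longrightarrow> (\<lambda>x. A x k) \<in> M \<rightarrow>\<^sub>M joint_action_space G"
  shows "(\<lambda>x. joint_action_law \<pi> t (S x) (A x)) \<in> M \<rightarrow>\<^sub>M prob_algebra (joint_action_space G)"
proof -
  have S': "(\<lambda>x. fst (S x k) i) \<in> M \<rightarrow>\<^sub>M local_space G i" if "k \<le> t" for k i
    using S[OF that] unfolding state_space_def by measurable
  have A': "(\<lambda>x. A x k i) \<in> M \<rightarrow>\<^sub>M action_space G i" if "k < t" for k i
    using A[OF that] unfolding joint_action_space_def by measurable
  have hist: "(\<lambda>x. local_history i t (S x) (A x)) \<in> M \<rightarrow>\<^sub>M history_space G i t" for i
    unfolding local_history_def history_space_def
    by (intro measurable_Pair measurable_restrict S' A') auto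
  have "\<pi> i t \<in> history_space G i t \<rightarrow>\<^sub>M prob_algebra (action_space G i)" for i
    using assms(1) unfolding is_policy_def by blast
  from measurable_compose[OF hist this] show ?thesis
    unfolding joint_action_law_def joint_action_space_def by (rule measurable_PiM_kernel)
qed

lemma measurable_step_kernel:
  assumes G: "is_gmdp G" and \<pi>: "is_policy G \<pi>" and s0: "s0 \<in> space (state_space G)"
  shows "step_kernel G \<pi> s0 t
    \<in> (\<Pi>\<^sub>M k\<in>{0..<t}. stage_space G) \<rightarrow>\<^sub>M prob_algebra (stage_space G)"
proof -
  let ?H = "\<Pi>\<^sub>M k\<in>{0..<t}. stage_space G"
  have \<omega>: "(\<lambda>\<omega>. \<omega> k) \<in> ?H \<rightarrow>\<^sub>M stage_space G" if "k < t" for k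
    using that by (intro measurable_component_singleton) simp
  have state: "(\<lambda>\<omega>. case t of 0 \<Rightarrow> return (state_space G) s0
      | Suc k \<Rightarrow> transition G (fst (\<omega> k)) (snd (\<omega> k))) \<in> ?H \<rightarrow>\<^sub>M prob_algebra (state_space G)"
  proof (cases t)
    case 0
    have "return (state_space G) s0 \<in> space (prob_algebra (state_space G))"
      using s0 by (simp add: space_prob_algebra prob_space_return)
    then show ?thesis
      using 0 by simp
  next
    case (Suc k)
    then show ?thesis
      using measurable_compose[OF \<omega>[of k] measurable_transition[OF G]] by simp
  qed
  let ?L = "\<lambda>x. joint_action_law \<pi> t ((\<lambda>k. fst (fst x k))(t := snd x)) (\<lambda>k. snd (fst x k))"
  have law: "?L \<in> ?H \<Otimes>\<^sub>M state_space G \<rightarrow>\<^sub>M prob_algebra (joint_action_space G)"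
  proof (rule measurable_joint_action_law[OF \<pi>])
    have \<omega>': "(\<lambda>x. fst x k) \<in> ?H \<Otimes>\<^sub>M state_space G \<rightarrow>\<^sub>M stage_space G" if "k < t" for k
      using measurable_compose[OF measurable_fst \<omega>[OF that]] .
    show "(\<lambda>x. ((\<lambda>k. fst (fst x k))(t := snd x)) k)
        \<in> ?H \<Otimes>\<^sub>M state_space G \<rightarrow>\<^sub>M state_space G" if "k \<le> t" for k
    proof (cases "k = t")
      case False
      with that have "(\<lambda>x. fst x k) \<in> ?H \<Otimes>\<^sub>M state_space G \<rightarrow>\<^sub>M stage_space G"
        by (intro \<omega>') auto
      then show ?thesis
        using False measurable_compose[OF _ measurable_fst] unfolding stage_space_def by simp
    qed simp
    show "(\<lambda>x. snd (fst x k)) \<in> ?H \<Otimes>\<^sub>M state_space G \<rightarrow>\<^sub>M joint_action_space G"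
      if "k < t" for k
      using measurable_compose[OF \<omega>'[OF that, unfolded stage_space_def] measurable_snd]
      unfolding stage_space_def .
  qed
  have "(\<lambda>x. distr (?L x) (stage_space G) (\<lambda>a. (snd x, a)))
      \<in> ?H \<Otimes>\<^sub>M state_space G \<rightarrow>\<^sub>M prob_algebra (stage_space G)"
    by (rule measurable_distr_prob_space2[OF law]) (unfold stage_space_def, measurable)
  then show ?thesis
    unfolding step_kernel_def by (intro measurable_bind_prob_space2[OF state]) (simp add: case_prod_beta)
qed

lemma Ionescu_Tulcea_step_kernel:
  assumes "is_gmdp G" and "is_policy G \<pi>" and "s0 \<in> space (state_space G)"
  shows "Ionescu_Tulcea (step_kernel G \<pi> s0) (\<lambda>_. stage_space G)"
proof (rule Ionescu_Tulcea.intro)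
  show "step_kernel G \<pi> s0 t \<in> (\<Pi>\<^sub>M k\<in>{0..<t}. stage_space G) \<rightarrow>\<^sub>M subprob_algebra (stage_space G)"
    for t
    by (rule measurable_prob_algebraD[OF measurable_step_kernel[OF assms]])
  show "prob_space (step_kernel G \<pi> s0 t \<omega>)"
    if "\<omega> \<in> space (\<Pi>\<^sub>M k\<in>{0..<t}. stage_space G)" for t \<omega>
    using measurable_space[OF measurable_step_kernel[OF assms] that]
    by (simp add: space_prob_algebra)
qed

end

theory Submission
  imports Defs
begin

text \<open>
  Every column of \<open>\<A> D\<^sup>-\<^sup>1\<close> sums to 1, because the \<open>j\<close>-th column sum of \<open>\<A>\<close> is the in-degree
  of \<open>j\<close>. Hence every column of \<open>\<Gamma>\<^sup>k\<close> sums to \<open>\<gamma>\<^sup>k\<close>, that is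
  \<open>\<one>\<^sup>T \<Gamma>\<^sup>k = \<gamma>\<^sup>k \<one>\<^sup>T\<close>, and the two discounted returns agree on each trajectory. Since the
  entries of \<open>\<Gamma>\<^sup>k\<close> are nonnegative, the same column sums bound \<open>\<Gamma>\<^sup>k R\<close> in the 1-norm by
  \<open>\<gamma>\<^sup>k\<close> times the 1-norm of \<open>R\<close>; for bounded rewards the diffusion return therefore converges
  absolutely and is integrable, so \<open>\<one>\<^sup>T\<close> may be moved inside the sum and the expectation.
\<close>

text \<open>Constant column sums say that the all-ones row vector is a left eigenvector, with the
  sum as eigenvalue. Passing it through \<open>X\<close> and then through \<open>Y\<close>
  multiplies the eigenvalues.\<close>

lemma column_sum_matrix_mult:
  fixes X :: "'a::comm_semiring_1 ^ 'n::finite ^ 'm::finite" and Y :: "'a ^ 'p ^ 'n"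
  assumes "\<And>j. (\<Sum>i\<in>UNIV. X $ i $ j) = a" and "\<And>j. (\<Sum>i\<in>UNIV. Y $ i $ j) = b"
  shows "(\<Sum>i\<in>UNIV. (X ** Y) $ i $ j) = a * b"
proof -
  have "(\<Sum>i\<in>UNIV. (X ** Y) $ i $ j) = (\<Sum>k\<in>UNIV. (\<Sum>i\<in>UNIV. X $ i $ k) * Y $ k $ j)"
    by (simp add: matrix_matrix_mult_def sum_distrib_right) (rule sum.swap)
  then show ?thesis
    by (simp add: assms sum_distrib_left[symmetric])
qed

lemma sum_matrix_vector_mult:
  fixes X :: "'a::comm_semiring_1 ^ 'n::finite ^ 'm::finite"
  assumes "\<And>j. (\<Sum>i\<in>UNIV. X $ i $ j) = a"
  shows "(\<Sum>i\<in>UNIV. (X *v v) $ i) = a * (\<Sum>j\<in>UNIV. v $ j)"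
proof -
  have "(\<Sum>i\<in>UNIV. (X *v v) $ i) = (\<Sum>k\<in>UNIV. (\<Sum>i\<in>UNIV. X $ i $ k) * v $ k)"
    by (simp add: matrix_vector_mult_def sum_distrib_right) (rule sum.swap)
  then show ?thesis
    by (simp add: assms sum_distrib_left[symmetric])
qed

text \<open>The Euclidean norm is at most the 1-norm. As the entries are nonnegative, absolute
  values can be moved onto \<open>v\<close>, and the column sums then give an exact value.\<close>

lemma norm_matrix_vector_mult_le:
  fixes X :: "real ^ 'n::finite ^ 'm::finite"
  assumes nonneg: "\<And>i j. 0 \<le> X $ i $ j" and col: "\<And>j. (\<Sum>i\<in>UNIV. X $ i $ j) = a"
  shows "norm (X *v v) \<le> a * (\<Sum>j\<in>UNIV. \<bar>v $ j\<bar>)"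
proof -
  have "norm (X *v v) \<le> (\<Sum>i\<in>UNIV. \<bar>(X *v v) $ i\<bar>)"
    by (rule norm_le_l1_cart)
  also have "\<dots> \<le> (\<Sum>i\<in>UNIV. (X *v (\<chi> j. \<bar>v $ j\<bar>)) $ i)"
  proof (rule sum_mono)
    fix i
    have "\<bar>(X *v v) $ i\<bar> \<le> (\<Sum>j\<in>UNIV. \<bar>X $ i $ j * v $ j\<bar>)"
      by (simp add: matrix_vector_mult_def sum_abs)
    then show "\<bar>(X *v v) $ i\<bar> \<le> (X *v (\<chi> j. \<bar>v $ j\<bar>)) $ i"
      by (simp add: matrix_vector_mult_def abs_mult nonneg)
  qed
  also have "\<dots> = a * (\<Sum>j\<in>UNIV. \<bar>v $ j\<bar>)"
    by (simp add: sum_matrix_vector_mult[OF col])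
  finally show ?thesis .
qed

lemma matrix_pow_Suc: "matrix_pow X (Suc k) = X ** matrix_pow X k"
  by (simp add: matrix_pow_def)

lemma matrix_pow_nonneg:
  assumes "\<And>i j. 0 \<le> X $ i $ j"
  shows "0 \<le> matrix_pow X k $ i $ j"
proof (induction k arbitrary: i j)
  case 0
  show ?case by (simp add: matrix_pow_def mat_def)
next
  case (Suc k)
  then show ?case
    using assms by (simp add: matrix_pow_Suc matrix_matrix_mult_def sum_nonneg)
qed

lemma column_sum_matrix_pow:
  assumes "\<And>j. (\<Sum>i\<in>UNIV. X $ i $ j) = a"
  shows "(\<Sum>i\<in>UNIV. matrix_pow X k $ i $ j) = a ^ k"
proof (induction k arbitrary: j)
  case 0
  show ?case by (simp add: matrix_pow_def mat_def)
next
  case (Suc k)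
  show ?case
    unfolding matrix_pow_Suc using column_sum_matrix_mult[OF assms Suc.IH] by simp
qed

text \<open>For square matrices over a field a right inverse is also a left inverse. So
  \<open>Y\<close> witnesses the choice that defines \<open>matrix_inv\<close>, and two-sided
  inverses coincide.\<close>

lemma matrix_inv_unique:
  fixes X Y :: "'a::field ^ 'n::finite ^ 'n"
  assumes "X ** Y = mat 1"
  shows "matrix_inv X = Y"
proof -
  have YX: "Y ** X = mat 1"
    by (rule matrix_left_right_inverse1[OF assms])
  have inv: "X ** matrix_inv X = mat 1 \<and> matrix_inv X ** X = mat 1"
    unfolding matrix_inv_def by (rule someI[where x = Y]) (rule conjI[OF assms YX])
  have "matrix_inv X = (Y ** X) ** matrix_inv X"
    by (simp only: YX matrix_mul_lid)
  also have "\<dots> = Y ** (X ** matrix_inv X)"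
    by (rule matrix_mul_assoc[symmetric])
  also have "\<dots> = Y"
    by (simp only: inv matrix_mul_rid)
  finally show ?thesis .
qed

lemma matrix_inv_diagonal:
  fixes d :: "'n::finite \<Rightarrow> 'a::field"
  assumes "\<And>i. d i \<noteq> 0"
  shows "matrix_inv (\<chi> i j. if i = j then d i else 0) = (\<chi> i j. if i = j then inverse (d i) else 0)"
  using assms
  by (intro matrix_inv_unique)
    (auto simp: matrix_matrix_mult_def mat_def vec_eq_iff if_distrib[of "\<lambda>x. x * _"] cong: if_cong)

text \<open>The self-loop at \<open>i\<close> alone contributes 1. This makes the in-degree matrix
  invertible.\<close>

lemma in_degree_pos:
  assumes "is_gmdp G"
  shows "0 < (\<Sum>k\<in>UNIV. adjacency G $ k $ i)"
proof -
  have "adjacency G $ i $ i = 1"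
    using assms by (simp add: adjacency_def is_gmdp_def)
  then show ?thesis
    by (intro sum_pos2[where i = i]) (auto simp: adjacency_def)
qed

text \<open>Multiplying on the right by a diagonal inverse divides column \<open>j\<close> by its
  diagonal entry, here the in-degree of \<open>j\<close>.\<close>

lemma diffusion_matrix_nth:
  assumes "is_gmdp G"
  shows "diffusion_matrix G \<gamma> $ i $ j =
    \<gamma> * (adjacency G $ i $ j / (\<Sum>k\<in>UNIV. adjacency G $ k $ j))"
proof -
  have "matrix_inv (in_degree_matrix G) =
      (\<chi> i j. if i = j then inverse (\<Sum>k\<in>UNIV. adjacency G $ k $ i) else 0)"
    unfolding in_degree_matrix_def
    by (rule matrix_inv_diagonal) (use in_degree_pos[OF assms] in \<open>metis less_irrefl\<close>)
  then show ?thesis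
    by (simp add: diffusion_matrix_def matrix_matrix_mult_def if_distrib[of "\<lambda>x. _ * x"]
        divide_inverse cong: if_cong)
qed

lemma diffusion_matrix_nonneg:
  assumes "is_gmdp G" and "0 \<le> \<gamma>"
  shows "0 \<le> diffusion_matrix G \<gamma> $ i $ j"
  using in_degree_pos[OF assms(1), of j] assms(2)
  by (simp add: diffusion_matrix_nth[OF assms(1)]) (simp add: adjacency_def)

lemma column_sum_diffusion_matrix:
  assumes "is_gmdp G"
  shows "(\<Sum>i\<in>UNIV. diffusion_matrix G \<gamma> $ i $ j) = \<gamma>"
  using in_degree_pos[OF assms, of j]
  by (simp add: diffusion_matrix_nth[OF assms] sum_distrib_left[symmetric]
      sum_divide_distrib[symmetric])

text \<open>A pushforward preserves total mass, so one marginal of mass 1 suffices; the simplest is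
  the one on the empty index set.\<close>

lemma (in Ionescu_Tulcea) prob_space_lim: "prob_space PF.lim"
proof (rule prob_space_distrD)
  show "(\<lambda>x. restrict x {}) \<in> PF.lim \<rightarrow>\<^sub>M PiM {} M"
    by (simp add: measurable_cong_sets[OF PF.sets_lim refl])
  show "prob_space (distr PF.lim (PiM {} M) (\<lambda>x. restrict x {}))"
    using PF.prob_space_P[of "{}"] by (simp add: distr_lim)
qed

lemma prob_space_trajectory_law:
  assumes "is_gmdp G" and "is_policy G \<pi>" and "S \<in> space (state_space G)"
  shows "prob_space (trajectory_law G \<pi> S)"
  unfolding trajectory_law_def
  by (rule Ionescu_Tulcea.prob_space_lim[OF Ionescu_Tulcea_step_kernel[OF assms]])

lemma sets_trajectory_law:
  assumes "is_gmdp G" and "is_policy G \<pi>" and "S \<in> space (state_space G)"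
  shows "sets (trajectory_law G \<pi> S) = sets (\<Pi>\<^sub>M t\<in>UNIV. stage_space G)"
proof -
  interpret Ionescu_Tulcea "step_kernel G \<pi> S" "\<lambda>_. stage_space G"
    by (rule Ionescu_Tulcea_step_kernel[OF assms])
  show ?thesis
    unfolding trajectory_law_def by (rule PF.sets_lim)
qed

lemma reward_vec_measurable:
  assumes "is_gmdp G"
  shows "(\<lambda>x. reward_vec G (fst x) (snd x) $ i) \<in> borel_measurable (stage_space G)"
proof -
  have "local_reward G i \<in> borel_measurable (nbhd_space G i)"
    using assms by (simp add: is_gmdp_def)
  from measurable_compose[OF measurable_nbhd_view this] show ?thesis
    by (simp add: reward_vec_def)
qed

text \<open>There are finitely many agents, so the largest of the agentwise bounds serves them
  all.\<close>

lemma bounded_rewardsE: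
  assumes "bounded_rewards G"
  obtains B where
    "\<And>i x. x \<in> space (stage_space G) \<Longrightarrow> \<bar>reward_vec G (fst x) (snd x) $ i\<bar> \<le> B"
proof -
  have "\<forall>i. \<exists>b. \<forall>y\<in>space (nbhd_space G i). \<bar>local_reward G i y\<bar> \<le> b"
    using assms by (simp add: bounded_rewards_def bounded_iff)
  then obtain b where b: "\<And>i y. y \<in> space (nbhd_space G i) \<Longrightarrow> \<bar>local_reward G i y\<bar> \<le> b i"
    by metis
  show thesis
  proof (rule that)
    fix i x assume "x \<in> space (stage_space G)"
    then have "\<bar>reward_vec G (fst x) (snd x) $ i\<bar> \<le> b i"
      unfolding reward_vec_def by (simp add: b[OF measurable_space[OF measurable_nbhd_view]])
    also have "b i \<le> Max (range b)" by simp
    finally show "\<bar>reward_vec G (fst x) (snd x) $ i\<bar> \<le> Max (range b)" .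
  qed
qed

theorem proposition3p3:
  fixes G :: "('n::finite, 's, 'z, 'a) gmdp"
    and \<pi> :: "('n, 's, 'a) joint_policy"
    and \<gamma> :: real
    and S :: "('n \<Rightarrow> 's) \<times> 'z"
  assumes "is_gmdp G"
    and "bounded_rewards G"
    and "is_policy G \<pi>"
    and "0 < \<gamma>" and "\<gamma> < 1"
    and "S \<in> space (state_space G)"
  shows "inverse (real CARD('n)) * ((\<chi> i. 1) \<bullet> diffusion_value G \<pi> \<gamma> S) = global_value G \<pi> \<gamma> S"
proof -
  let ?M = "trajectory_law G \<pi> S"
  define P where "P t = matrix_pow (diffusion_matrix G \<gamma>) (t + 1)" for t
  define R where "R \<omega> t = reward_vec G (fst (\<omega> t)) (snd (\<omega> t))" for \<omega> and t :: nat
  let ?one = "(\<chi> i. 1) :: real ^ 'n"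
  obtain B where B: "\<And>i x. x \<in> space (stage_space G) \<Longrightarrow> \<bar>reward_vec G (fst x) (snd x) $ i\<bar> \<le> B"
    using bounded_rewardsE[OF assms(2)] by metis
  interpret prob_space ?M
    by (rule prob_space_trajectory_law[OF assms(1,3,6)])
  note sets_M = sets_trajectory_law[OF assms(1,3,6)]

  have P_nonneg: "0 \<le> P t $ i $ j" for t i j
    unfolding P_def using assms(4)
    by (intro matrix_pow_nonneg diffusion_matrix_nonneg[OF assms(1)]) simp
  have P_col: "(\<Sum>i\<in>UNIV. P t $ i $ j) = \<gamma> ^ (t + 1)" for t j
    unfolding P_def by (intro column_sum_matrix_pow column_sum_diffusion_matrix[OF assms(1)])

  \<comment> \<open>The factor \<open>real CARD('n) * B\<close> bounds the 1-norm of the reward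
    vector. The bound does not depend on \<open>\<omega>\<close>, so it yields both convergence of
    the series and a constant majorant for integrability.\<close>
  have norm_le: "norm (P t *v R \<omega> t) \<le> \<gamma> ^ (t + 1) * (real CARD('n) * B)"
    if "\<omega> \<in> space ?M" for t \<omega>
  proof -
    have "\<omega> t \<in> space (stage_space G)"
      using that sets_eq_imp_space_eq[OF sets_M] by (auto simp: space_PiM)
    then have "(\<Sum>j\<in>UNIV. \<bar>R \<omega> t $ j\<bar>) \<le> real CARD('n) * B"
      unfolding R_def using B by (intro sum_bounded_above) auto
    then have "\<gamma> ^ (t + 1) * (\<Sum>j\<in>UNIV. \<bar>R \<omega> t $ j\<bar>) \<le> \<gamma> ^ (t + 1) * (real CARD('n) * B)"
      using assms(4) by (intro mult_left_mono) auto
    then show ?thesis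
      using norm_matrix_vector_mult_le[OF P_nonneg P_col, of t "R \<omega> t"] by linarith
  qed
  have geometric: "summable (\<lambda>t. \<gamma> ^ (t + 1) * (real CARD('n) * B))"
    using assms(4,5) by (intro summable_mult2 summable_ignore_initial_segment summable_geometric) simp
  have summable: "summable (\<lambda>t. P t *v R \<omega> t)" if "\<omega> \<in> space ?M" for \<omega>
    by (rule summable_comparison_test'[OF geometric norm_le[OF that]])

  have R_meas [measurable]: "(\<lambda>\<omega>. R \<omega> t $ i) \<in> borel_measurable ?M" for t i
  proof -
    have "(\<lambda>\<omega>. \<omega> t) \<in> ?M \<rightarrow>\<^sub>M stage_space G"
      by (simp add: measurable_cong_sets[OF sets_M refl])
    from measurable_compose[OF this reward_vec_measurable[OF assms(1)]] show ?thesis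
      by (simp add: R_def)
  qed
  have integrable: "integrable ?M (\<lambda>\<omega>. \<Sum>t. P t *v R \<omega> t)"
  proof (rule integrable_const_bound)
    show "AE \<omega> in ?M. norm (\<Sum>t. P t *v R \<omega> t) \<le> (\<Sum>t. \<gamma> ^ (t + 1) * (real CARD('n) * B))"
      by (intro AE_I2 norm_suminf_le norm_le geometric)
    show "(\<lambda>\<omega>. \<Sum>t. P t *v R \<omega> t) \<in> borel_measurable ?M"
      \<comment> \<open>Writing the product as a combination of fixed columns of \<open>P t\<close>
        leaves only the real coefficients \<open>R \<omega> t $ i\<close> depending on
        \<open>\<omega>\<close>.\<close>
      unfolding matrix_mult_sum scalar_mult_eq_scaleR by measurable
  qed

  have one_inner: "?one \<bullet> v = (\<Sum>i\<in>UNIV. v $ i)" for v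
    by (simp add: inner_vec_def)
  have return_eq: "inverse (real CARD('n)) * (?one \<bullet> (\<Sum>t. P t *v R \<omega> t)) =
      (\<Sum>t. \<gamma> ^ (t + 1) * global_reward G (fst (\<omega> t)) (snd (\<omega> t)))" if "\<omega> \<in> space ?M" for \<omega>
  proof -
    have "inverse (real CARD('n)) * (?one \<bullet> (\<Sum>t. P t *v R \<omega> t)) =
        (\<Sum>t. inverse (real CARD('n)) * (?one \<bullet> (P t *v R \<omega> t)))"
      using summable[OF that]
      \<comment> \<open>Averaging the coordinates is a bounded linear functional, hence commutes
        with the convergent series.\<close>
      by (intro bounded_linear.suminf[where f = "\<lambda>v. inverse (real CARD('n)) * (?one \<bullet> v)"]
          bounded_linear_const_mult bounded_linear_inner_right)
    also have "\<dots> = (\<Sum>t. \<gamma> ^ (t + 1) * global_reward G (fst (\<omega> t)) (snd (\<omega> t)))"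
      by (simp add: one_inner sum_matrix_vector_mult[OF P_col] global_reward_def R_def
          reward_vec_def mult.left_commute)
    finally show ?thesis .
  qed

  have "inverse (real CARD('n)) * (?one \<bullet> diffusion_value G \<pi> \<gamma> S) =
      (\<integral>\<omega>. inverse (real CARD('n)) * (?one \<bullet> (\<Sum>t. P t *v R \<omega> t)) \<partial>?M)"
    using integrable by (simp add: diffusion_value_def P_def R_def)
  \<comment> \<open>The two integrands agree at every trajectory in the carrier, not merely almost
    surely.\<close>
  also have "\<dots> = global_value G \<pi> \<gamma> S"
    unfolding global_value_def by (intro Bochner_Integration.integral_cong refl return_eq)
  finally show ?thesis .
qed

end
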